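(* There exist a $C^*$-algebra $\mathfrak{A}$, Hilbert $\mathfrak{A}$-modules $H$ and $K$, and operators $T\in\mathcal{L}(H,K)$ and $T'\in\mathcal{L}(K)$ such that $\mathcal{R}(T')$ is properly contained in $\mathcal{R}(T)$, whereas the equation $TX=T'$ for $X\in\mathcal{L}(K,H)$ has no solution.
   Context: Hilbert $\mathfrak{A}$-modules are right modules over the $C^*$-algebra $\mathfrak{A}$ with an $\mathfrak{A}$-valued inner product $\langle\cdot,\cdot\rangle$ that is conjugate-linear in the first and linear (over $\mathbb{C}$ and $\mathfrak{A}$) in the second variable, complete in the norm $\Vert x\Vert=\sqrt{\Vert\langle x,x\rangle\Vert}$. $\mathcal{L}(H,K)$ denotes the set of adjointable operators $T:H\to K$, i.e. those for which there is $T^*:K\to H$ with $\langle Tx,y\rangle=\langle x,T^*y\rangle$ for all $x\in H$, $y\in K$; $\mathcal{L}(K)=\mathcal{L}(K,K)$. $\mathcal{R}(T)$ denotes the range of $T$. *)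

theory Defs
  imports Complex_Main "HOL-Algebra.Module"
begin

text \<open>All structures are carrier-based, since HOL cannot quantify existentially over types.
  Complex vector spaces are modules, in the sense of HOL-Algebra, over the following ring.\<close>

definition complex_ring :: "complex ring" where
  "complex_ring = \<lparr>carrier = UNIV, monoid.mult = (*), one = 1, zero = 0, add = (+)\<rparr>"

definition norm_complete :: "('a, 'm) ring_scheme \<Rightarrow> ('a \<Rightarrow> real) \<Rightarrow> bool" where
  "norm_complete V N \<longleftrightarrow>
    (\<forall>s::nat \<Rightarrow> 'a. range s \<subseteq> carrier V \<longrightarrow>
       (\<forall>e>0. \<exists>n0. \<forall>m\<ge>n0. \<forall>n\<ge>n0. N (s m \<ominus>\<^bsub>V\<^esub> s n) < e) \<longrightarrow>
       (\<exists>x\<in>carrier V. (\<lambda>n. N (s n \<ominus>\<^bsub>V\<^esub> x)) \<longlonglongrightarrow> 0))"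

text \<open>A \<open>C\<^sup>*\<close>-algebra need not be unital. The record field \<^const>\<open>one\<close>,
  inherited from \<^typ>\<open>(complex, 'a) module\<close>, is not constrained.\<close>

record 'a cstar = "(complex, 'a) module" +
  star :: "'a \<Rightarrow> 'a"
  nrm :: "'a \<Rightarrow> real"

locale cstar_algebra = Module.module complex_ring A for A :: "'a cstar" (structure) +
  assumes mult_closed: "\<lbrakk>x \<in> carrier A; y \<in> carrier A\<rbrakk> \<Longrightarrow> x \<otimes> y \<in> carrier A"
    and mult_assoc: "\<lbrakk>x \<in> carrier A; y \<in> carrier A; z \<in> carrier A\<rbrakk> \<Longrightarrow>
      (x \<otimes> y) \<otimes> z = x \<otimes> (y \<otimes> z)"
    and mult_l_distr: "\<lbrakk>x \<in> carrier A; y \<in> carrier A; z \<in> carrier A\<rbrakk> \<Longrightarrow>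
      (x \<oplus> y) \<otimes> z = x \<otimes> z \<oplus> y \<otimes> z"
    and mult_r_distr: "\<lbrakk>x \<in> carrier A; y \<in> carrier A; z \<in> carrier A\<rbrakk> \<Longrightarrow>
      z \<otimes> (x \<oplus> y) = z \<otimes> x \<oplus> z \<otimes> y"
    and smult_mult_l: "\<lbrakk>x \<in> carrier A; y \<in> carrier A\<rbrakk> \<Longrightarrow> (c \<odot> x) \<otimes> y = c \<odot> (x \<otimes> y)"
    and smult_mult_r: "\<lbrakk>x \<in> carrier A; y \<in> carrier A\<rbrakk> \<Longrightarrow> x \<otimes> (c \<odot> y) = c \<odot> (x \<otimes> y)"
    and star_closed: "x \<in> carrier A \<Longrightarrow> star A x \<in> carrier A"
    and star_star: "x \<in> carrier A \<Longrightarrow> star A (star A x) = x"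
    and star_add: "\<lbrakk>x \<in> carrier A; y \<in> carrier A\<rbrakk> \<Longrightarrow> star A (x \<oplus> y) = star A x \<oplus> star A y"
    and star_smult: "x \<in> carrier A \<Longrightarrow> star A (c \<odot> x) = cnj c \<odot> star A x"
    and star_mult: "\<lbrakk>x \<in> carrier A; y \<in> carrier A\<rbrakk> \<Longrightarrow> star A (x \<otimes> y) = star A y \<otimes> star A x"
    and nrm_nonneg: "x \<in> carrier A \<Longrightarrow> 0 \<le> nrm A x"
    and nrm_eq_0: "x \<in> carrier A \<Longrightarrow> nrm A x = 0 \<longleftrightarrow> x = \<zero>"
    and nrm_add: "\<lbrakk>x \<in> carrier A; y \<in> carrier A\<rbrakk> \<Longrightarrow> nrm A (x \<oplus> y) \<le> nrm A x + nrm A y"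
    and nrm_smult: "x \<in> carrier A \<Longrightarrow> nrm A (c \<odot> x) = cmod c * nrm A x"
    and nrm_mult: "\<lbrakk>x \<in> carrier A; y \<in> carrier A\<rbrakk> \<Longrightarrow> nrm A (x \<otimes> y) \<le> nrm A x * nrm A y"
    and nrm_cstar: "x \<in> carrier A \<Longrightarrow> nrm A (star A x \<otimes> x) = (nrm A x)\<^sup>2"
    and nrm_complete: "norm_complete A (nrm A)"

definition positive_element :: "'a cstar \<Rightarrow> 'a \<Rightarrow> bool" where
  "positive_element A a \<longleftrightarrow> (\<exists>b\<in>carrier A. a = star A b \<otimes>\<^bsub>A\<^esub> b)"

text \<open>\<open>act H x a\<close> is the right action \<open>x a\<close> and \<open>ip H x y\<close> is the inner product of \<open>x\<close> and \<open>y\<close>.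
  The inherited fields \<^const>\<open>monoid.mult\<close> and \<^const>\<open>one\<close> play no role.\<close>

record ('a, 'h) hmod = "(complex, 'h) module" +
  act :: "'h \<Rightarrow> 'a \<Rightarrow> 'h"
  ip :: "'h \<Rightarrow> 'h \<Rightarrow> 'a"

definition hnorm :: "'a cstar \<Rightarrow> ('a, 'h) hmod \<Rightarrow> 'h \<Rightarrow> real" where
  "hnorm A H x = sqrt (nrm A (ip H x x))"

text \<open>Conjugate-linearity of the inner product in the first variable follows from
  \<open>ip_star\<close> and linearity in the second one.\<close>

locale hilbert_module = cstar_algebra A + H: Module.module complex_ring H
  for A :: "'a cstar" (structure) and H :: "('a, 'h) hmod" +
  assumes act_closed: "\<lbrakk>x \<in> carrier H; a \<in> carrier A\<rbrakk> \<Longrightarrow> act H x a \<in> carrier H"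
    and act_add_l: "\<lbrakk>x \<in> carrier H; y \<in> carrier H; a \<in> carrier A\<rbrakk> \<Longrightarrow>
      act H (x \<oplus>\<^bsub>H\<^esub> y) a = act H x a \<oplus>\<^bsub>H\<^esub> act H y a"
    and act_add_r: "\<lbrakk>x \<in> carrier H; a \<in> carrier A; b \<in> carrier A\<rbrakk> \<Longrightarrow>
      act H x (a \<oplus> b) = act H x a \<oplus>\<^bsub>H\<^esub> act H x b"
    and act_mult: "\<lbrakk>x \<in> carrier H; a \<in> carrier A; b \<in> carrier A\<rbrakk> \<Longrightarrow>
      act H x (a \<otimes> b) = act H (act H x a) b"
    and act_smult_l: "\<lbrakk>x \<in> carrier H; a \<in> carrier A\<rbrakk> \<Longrightarrow>
      act H (c \<odot>\<^bsub>H\<^esub> x) a = c \<odot>\<^bsub>H\<^esub> act H x a"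
    and act_smult_r: "\<lbrakk>x \<in> carrier H; a \<in> carrier A\<rbrakk> \<Longrightarrow>
      act H x (c \<odot> a) = c \<odot>\<^bsub>H\<^esub> act H x a"
    and ip_closed: "\<lbrakk>x \<in> carrier H; y \<in> carrier H\<rbrakk> \<Longrightarrow> ip H x y \<in> carrier A"
    and ip_add: "\<lbrakk>x \<in> carrier H; y \<in> carrier H; z \<in> carrier H\<rbrakk> \<Longrightarrow>
      ip H x (y \<oplus>\<^bsub>H\<^esub> z) = ip H x y \<oplus> ip H x z"
    and ip_smult: "\<lbrakk>x \<in> carrier H; y \<in> carrier H\<rbrakk> \<Longrightarrow> ip H x (c \<odot>\<^bsub>H\<^esub> y) = c \<odot> ip H x y"
    and ip_act: "\<lbrakk>x \<in> carrier H; y \<in> carrier H; a \<in> carrier A\<rbrakk> \<Longrightarrow>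
      ip H x (act H y a) = ip H x y \<otimes> a"
    and ip_star: "\<lbrakk>x \<in> carrier H; y \<in> carrier H\<rbrakk> \<Longrightarrow> ip H y x = star A (ip H x y)"
    and ip_positive: "x \<in> carrier H \<Longrightarrow> positive_element A (ip H x x)"
    and ip_definite: "\<lbrakk>x \<in> carrier H; ip H x x = \<zero>\<rbrakk> \<Longrightarrow> x = \<zero>\<^bsub>H\<^esub>"
    and hnorm_complete: "norm_complete H (hnorm A H)"

text \<open>As usual, linearity and boundedness are not demanded: they follow from the existence of
  an adjoint. Only the values on \<^term>\<open>carrier H\<close> matter.\<close>

definition adjointable :: "('a, 'h) hmod \<Rightarrow> ('a, 'k) hmod \<Rightarrow> ('h \<Rightarrow> 'k) set" where
  "adjointable H K = {T \<in> carrier H \<rightarrow> carrier K.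
     \<exists>S \<in> carrier K \<rightarrow> carrier H. \<forall>x\<in>carrier H. \<forall>y\<in>carrier K. ip K (T x) y = ip H x (S y)}"

end

theory Submission
  imports Defs "HOL-Analysis.Uniform_Limit"
begin

text \<open>
  The \<open>C\<^sup>*\<close>-algebra is \<open>A = \<ell>\<^sup>\<infinity>\<close>, and both modules are uniformly closed ideals of it, with
  inner product \<open>\<langle>x, y\<rangle> = x\<^sup>* y\<close>: \<open>H = A\<close> and \<open>K = c\<^sub>0\<close>. Fix a nowhere vanishing \<open>f \<in> c\<^sub>0\<close>, and let
  both \<open>T: H \<rightarrow> K\<close> and \<open>T': K \<rightarrow> K\<close> be multiplication by \<open>f\<close>, so that \<open>T'\<close> is the restriction of
  \<open>T\<close> to \<open>K \<subset> H\<close>. Multiplication by \<open>f\<close> is injective, so \<open>\<R>(T') = f c\<^sub>0\<close> is properly contained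
  in \<open>\<R>(T) = f \<ell>\<^sup>\<infinity>\<close>, and the only map \<open>X\<close> with \<open>T X = T'\<close> is the inclusion \<open>c\<^sub>0 \<rightarrow> \<ell>\<^sup>\<infinity>\<close>.

  That inclusion is not adjointable: an adjoint \<open>S\<close> would satisfy \<open>y\<^sup>* = y\<^sup>* S(1)\<close> for all
  \<open>y \<in> c\<^sub>0\<close>, which forces \<open>S(1) = 1\<close>, whereas \<open>S(1)\<close> must lie in \<open>c\<^sub>0\<close>. What fails is that the
  ideal \<open>c\<^sub>0\<close> is not orthogonally complemented in \<open>\<ell>\<^sup>\<infinity>\<close>.

  That the ideals are Hilbert modules is shown once, for any uniformly closed ideal
  (\<open>hilbert_module_ideal\<close>); the norm induced by the inner product is the supremum norm, so
  completeness is the Cauchy criterion for uniform convergence.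
\<close>

section \<open>The supremum norm\<close>

definition supnorm :: "(nat \<Rightarrow> complex) \<Rightarrow> real" where
  "supnorm x = (SUP n. cmod (x n))"

lemma cmod_le_supnorm: "Bseq x \<Longrightarrow> cmod (x n) \<le> supnorm x"
  unfolding supnorm_def by (intro cSUP_upper Bseq_bdd_above') auto

lemma supnorm_le: "(\<And>n. cmod (x n) \<le> b) \<Longrightarrow> supnorm x \<le> b"
  unfolding supnorm_def by (intro cSUP_least) auto

lemma supnorm_nonneg: "Bseq x \<Longrightarrow> 0 \<le> supnorm x"
  using cmod_le_supnorm[of x 0] norm_ge_zero order_trans by blast

lemma supnorm_eq_0: "Bseq x \<Longrightarrow> supnorm x = 0 \<longleftrightarrow> x = (\<lambda>n. 0)"
  using cmod_le_supnorm[of x] by (auto simp: fun_eq_iff supnorm_def)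

lemma supnorm_add:
  assumes "Bseq x" "Bseq y"
  shows "supnorm (\<lambda>n. x n + y n) \<le> supnorm x + supnorm y"
  by (intro supnorm_le norm_triangle_le add_mono cmod_le_supnorm assms)

lemma supnorm_mult:
  assumes "Bseq x" "Bseq y"
  shows "supnorm (\<lambda>n. x n * y n) \<le> supnorm x * supnorm y"
  by (intro supnorm_le)
    (auto simp: norm_mult intro!: mult_mono cmod_le_supnorm supnorm_nonneg assms)

lemma Bseq_plus:
  fixes x y :: "nat \<Rightarrow> complex"
  assumes "Bseq x" "Bseq y"
  shows "Bseq (\<lambda>n. x n + y n)"
  by (rule BseqI'[of _ "supnorm x + supnorm y"])
    (intro norm_triangle_le add_mono cmod_le_supnorm assms)

lemma supnorm_scale:
  assumes "Bseq x"
  shows "supnorm (\<lambda>n. c * x n) = cmod c * supnorm x"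
proof (cases "c = 0")
  case True
  then show ?thesis by (simp add: supnorm_def)
next
  case False
  have "supnorm (\<lambda>n. c * x n) \<le> cmod c * supnorm x"
    by (intro supnorm_le) (auto simp: norm_mult intro!: mult_left_mono cmod_le_supnorm assms)
  moreover have "supnorm x \<le> supnorm (\<lambda>n. c * x n) / cmod c"
  proof (rule supnorm_le)
    fix n
    have "Bseq (\<lambda>n. c * x n)"
      using assms False by (simp add: Bseq_cmult_iff)
    from cmod_le_supnorm[OF this, of n] show "cmod (x n) \<le> supnorm (\<lambda>n. c * x n) / cmod c"
      using False by (simp add: norm_mult field_simps)
  qed
  ultimately show ?thesis using False by (simp add: field_simps)
qed

lemma Bseq_cnj: "Bseq x \<Longrightarrow> Bseq (\<lambda>n. cnj (x n))"
  by (simp add: Bseq_def)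

lemma supnorm_cnj_mult:
  assumes "Bseq x"
  shows "supnorm (\<lambda>n. cnj (x n) * x n) = (supnorm x)\<^sup>2"
proof (rule antisym)
  show "supnorm (\<lambda>n. cnj (x n) * x n) \<le> (supnorm x)\<^sup>2"
    by (intro supnorm_le)
      (auto simp: norm_mult power2_eq_square intro!: mult_mono cmod_le_supnorm supnorm_nonneg assms)
  have B: "Bseq (\<lambda>n. cnj (x n) * x n)"
    using assms by (intro Bseq_mult Bseq_cnj)
  have "supnorm x \<le> sqrt (supnorm (\<lambda>n. cnj (x n) * x n))"
  proof (rule supnorm_le)
    fix n
    show "cmod (x n) \<le> sqrt (supnorm (\<lambda>n. cnj (x n) * x n))"
      using cmod_le_supnorm[OF B, of n]
      by (intro real_le_rsqrt) (simp add: norm_mult power2_eq_square)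
  qed
  then show "(supnorm x)\<^sup>2 \<le> supnorm (\<lambda>n. cnj (x n) * x n)"
    using supnorm_nonneg[OF assms] supnorm_nonneg[OF B] by (metis power_mono real_sqrt_pow2)
qed

section \<open>Uniformly closed ideals of the bounded sequences\<close>

definition bounded_seqs :: "(nat \<Rightarrow> complex) cstar" where
  "bounded_seqs = \<lparr>carrier = {x. Bseq x}, monoid.mult = (\<lambda>x y n. x n * y n), one = (\<lambda>n. 1),
     zero = (\<lambda>n. 0), add = (\<lambda>x y n. x n + y n), smult = (\<lambda>c x n. c * x n),
     star = (\<lambda>x n. cnj (x n)), nrm = supnorm\<rparr>"

definition ideal_hmod :: "(nat \<Rightarrow> complex) set \<Rightarrow> (nat \<Rightarrow> complex, nat \<Rightarrow> complex) hmod" where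
  "ideal_hmod E = \<lparr>carrier = E, monoid.mult = (\<lambda>x y n. x n * y n), one = (\<lambda>n. 1),
     zero = (\<lambda>n. 0), add = (\<lambda>x y n. x n + y n), smult = (\<lambda>c x n. c * x n),
     act = (\<lambda>x a n. x n * a n), ip = (\<lambda>x y n. cnj (x n) * y n)\<rparr>"

locale closed_ideal =
  fixes E :: "(nat \<Rightarrow> complex) set"
  assumes bounded: "x \<in> E \<Longrightarrow> Bseq x"
    and zero_closed: "(\<lambda>n. 0) \<in> E"
    and add_closed: "\<lbrakk>x \<in> E; y \<in> E\<rbrakk> \<Longrightarrow> (\<lambda>n. x n + y n) \<in> E"
    and mult_closed: "\<lbrakk>x \<in> E; Bseq a\<rbrakk> \<Longrightarrow> (\<lambda>n. x n * a n) \<in> E"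
    and limit_closed: "\<lbrakk>\<And>k. s k \<in> E; uniform_limit UNIV s x sequentially\<rbrakk> \<Longrightarrow> x \<in> E"
begin

lemma scale_closed: "x \<in> E \<Longrightarrow> (\<lambda>n. c * x n) \<in> E"
  using mult_closed[of x "\<lambda>n. c"] by (simp add: mult.commute)

lemma uminus_closed: "x \<in> E \<Longrightarrow> (\<lambda>n. - x n) \<in> E"
  using scale_closed[of x "-1"] by simp

lemma diff_closed: "\<lbrakk>x \<in> E; y \<in> E\<rbrakk> \<Longrightarrow> (\<lambda>n. x n - y n) \<in> E"
  using add_closed[of x "\<lambda>n. - y n"] uminus_closed[of y] by simp

end

lemma cring_complex: "cring complex_ring"
proof (rule cringI)
  show "abelian_group complex_ring"
    by (rule abelian_groupI)
      (auto simp: complex_ring_def algebra_simps intro: exI[of _ "- x" for x])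
  show "comm_monoid complex_ring"
    by unfold_locales (auto simp: complex_ring_def)
qed (auto simp: complex_ring_def algebra_simps)

text \<open>The algebra itself and the modules over it are records of different types; both extend the
  module records, so their linear structure and their completeness are treated here together.\<close>

locale pointwise_module = closed_ideal E for E +
  fixes V :: "(complex, nat \<Rightarrow> complex, 'm) module_scheme"
  assumes carrier_V: "carrier V = E"
    and zero_V: "zero V = (\<lambda>n. 0)"
    and add_V: "add V = (\<lambda>x y n. x n + y n)"
    and smult_V: "smult V = (\<lambda>c x n. c * x n)"
begin

lemma abelian_group_V: "abelian_group V"
proof (rule abelian_groupI)
  fix x assume "x \<in> carrier V"
  then show "\<exists>y\<in>carrier V. y \<oplus>\<^bsub>V\<^esub> x = \<zero>\<^bsub>V\<^esub>"
    by (intro bexI[of _ "\<lambda>n. - x n"]) (auto simp: carrier_V zero_V add_V uminus_closed)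
qed (auto simp: carrier_V zero_V add_V zero_closed add_closed algebra_simps)

lemma module_V: "Module.module complex_ring V"
  by (rule moduleI[OF cring_complex abelian_group_V])
    (auto simp: carrier_V smult_V add_V complex_ring_def scale_closed algebra_simps)

lemma minus_V:
  assumes "x \<in> E" "y \<in> E"
  shows "x \<ominus>\<^bsub>V\<^esub> y = (\<lambda>n. x n - y n)"
proof -
  interpret V: abelian_group V by (rule abelian_group_V)
  have "\<ominus>\<^bsub>V\<^esub> y = (\<lambda>n. - y n)"
    using assms by (intro V.minus_equality) (auto simp: carrier_V zero_V add_V uminus_closed)
  then show ?thesis by (simp add: a_minus_def add_V)
qed

lemma norm_complete_V:
  assumes N: "\<And>x. x \<in> E \<Longrightarrow> N x = supnorm x"
  shows "norm_complete V N"
  unfolding norm_complete_def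
proof (intro allI impI)
  fix s :: "nat \<Rightarrow> nat \<Rightarrow> complex"
  assume "range s \<subseteq> carrier V"
  then have s: "s k \<in> E" for k by (auto simp: carrier_V)
  have N_diff: "N (x \<ominus>\<^bsub>V\<^esub> y) = supnorm (\<lambda>n. x n - y n)" if "x \<in> E" "y \<in> E" for x y
    using that by (simp add: minus_V N diff_closed)
  assume Cauchy: "\<forall>e>0. \<exists>n0. \<forall>m\<ge>n0. \<forall>n\<ge>n0. N (s m \<ominus>\<^bsub>V\<^esub> s n) < e"
  have "uniformly_Cauchy_on UNIV s"
  proof (rule uniformly_Cauchy_onI)
    fix e :: real assume "e > 0"
    with Cauchy s obtain n0 where
      n0: "\<forall>m\<ge>n0. \<forall>n\<ge>n0. supnorm (\<lambda>i. s m i - s n i) < e"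
      by (auto simp: N_diff)
    have "dist (s m i) (s n i) < e" if "m \<ge> n0" "n \<ge> n0" for m n i
      using cmod_le_supnorm[OF bounded[OF diff_closed[OF s[of m] s[of n]]], of i] n0 that
      by (force simp: dist_norm)
    then show "\<exists>M. \<forall>i\<in>UNIV. \<forall>m\<ge>M. \<forall>n\<ge>M. dist (s m i) (s n i) < e" by blast
  qed
  then obtain x where lim: "uniform_limit UNIV s x sequentially"
    using Cauchy_uniformly_convergent unfolding uniformly_convergent_on_def by blast
  have x: "x \<in> E"
    using s lim by (rule limit_closed)
  have "(\<lambda>n. supnorm (\<lambda>i. s n i - x i)) \<longlonglongrightarrow> 0"
  proof (rule LIMSEQ_I)
    fix r :: real assume "r > 0"
    then have "r / 2 > 0" by simp
    with lim obtain M where M: "dist (s n i) (x i) < r / 2" if "n \<ge> M" for n i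
      unfolding uniform_limit_sequentially_iff by blast
    have "norm (supnorm (\<lambda>i. s n i - x i) - 0) < r" if "n \<ge> M" for n
    proof -
      have "supnorm (\<lambda>i. s n i - x i) \<le> r / 2"
        using M[OF that] by (intro supnorm_le) (auto simp: dist_norm less_imp_le)
      then show ?thesis
        using \<open>r > 0\<close> supnorm_nonneg[OF bounded[OF diff_closed[OF s[of n] x]]] by simp
    qed
    then show "\<exists>M. \<forall>n\<ge>M. norm (supnorm (\<lambda>i. s n i - x i) - 0) < r" by blast
  qed
  then show "\<exists>x\<in>carrier V. (\<lambda>n. N (s n \<ominus>\<^bsub>V\<^esub> x)) \<longlonglongrightarrow> 0"
    using x s by (auto simp: carrier_V N_diff)
qed

end

lemma closed_ideal_bounded: "closed_ideal {x. Bseq x}"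
proof
  fix s :: "nat \<Rightarrow> nat \<Rightarrow> complex" and x
  assume s: "s k \<in> {x. Bseq x}" for k
  assume "uniform_limit UNIV s x sequentially"
  then obtain k where "\<forall>i. dist (s k i) (x i) < 1"
    unfolding uniform_limit_sequentially_iff by (metis UNIV_I order_refl zero_less_one)
  then have "Bseq (\<lambda>i. x i - s k i)"
    by (intro BseqI'[of _ 1] less_imp_le) (simp add: dist_norm norm_minus_commute)
  from Bseq_plus[OF this, of "s k"] show "x \<in> {x. Bseq x}"
    using s[of k] by simp
qed (auto intro: Bseq_mult Bseq_plus)

lemma closed_ideal_null: "closed_ideal {x. x \<longlonglongrightarrow> 0}"
proof
  fix x a :: "nat \<Rightarrow> complex" assume "x \<in> {x. x \<longlonglongrightarrow> 0}" "Bseq a"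
  then show "(\<lambda>n. x n * a n) \<in> {x. x \<longlonglongrightarrow> 0}"
    using bounded_bilinear.Zfun_prod_Bfun[OF bounded_bilinear_mult, of x sequentially a]
    by (simp add: tendsto_Zfun_iff)
next
  fix s :: "nat \<Rightarrow> nat \<Rightarrow> complex" and x
  assume "s k \<in> {x. x \<longlonglongrightarrow> 0}" for k
  moreover assume "uniform_limit UNIV s x sequentially"
  ultimately show "x \<in> {x. x \<longlonglongrightarrow> 0}"
    \<comment> \<open>A uniform limit may be interchanged with the limit along the sequence.\<close>
    using swap_uniform_limit'[of s "\<lambda>k. 0" sequentially sequentially 0 UNIV x] by simp
qed (auto intro: tendsto_add_zero convergent_imp_Bseq convergentI)

lemma cstar_algebra_bounded_seqs: "cstar_algebra bounded_seqs"
proof -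
  interpret pointwise_module "{x. Bseq x}" bounded_seqs
    by (intro pointwise_module.intro closed_ideal_bounded pointwise_module_axioms.intro)
      (auto simp: bounded_seqs_def)
  note [simp] = bounded_seqs_def
  show ?thesis
  proof (intro cstar_algebra.intro module_V cstar_algebra_axioms.intro)
    show "norm_complete bounded_seqs (nrm bounded_seqs)"
      by (rule norm_complete_V) simp
    fix x assume "x \<in> carrier bounded_seqs"
    then show "nrm bounded_seqs (star bounded_seqs x \<otimes>\<^bsub>bounded_seqs\<^esub> x) = (nrm bounded_seqs x)\<^sup>2"
      by (simp add: supnorm_cnj_mult)
  qed (auto simp: algebra_simps Bseq_cnj supnorm_nonneg supnorm_eq_0 supnorm_add supnorm_scale
      supnorm_mult intro: Bseq_mult)
qed

lemma hilbert_module_ideal: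
  assumes "closed_ideal E"
  shows "hilbert_module bounded_seqs (ideal_hmod E)"
proof -
  interpret pointwise_module E "ideal_hmod E"
    by (intro pointwise_module.intro assms pointwise_module_axioms.intro)
      (auto simp: ideal_hmod_def)
  have hnorm: "hnorm bounded_seqs (ideal_hmod E) x = supnorm x" if "x \<in> E" for x
    using bounded[OF that]
    by (simp add: hnorm_def bounded_seqs_def ideal_hmod_def supnorm_cnj_mult supnorm_nonneg)
  show ?thesis
  proof (intro hilbert_module.intro cstar_algebra_bounded_seqs module_V hilbert_module_axioms.intro)
    show "norm_complete (ideal_hmod E) (hnorm bounded_seqs (ideal_hmod E))"
      by (rule norm_complete_V) (rule hnorm)
  next
    fix x assume "x \<in> carrier (ideal_hmod E)"
    then show "positive_element bounded_seqs (ip (ideal_hmod E) x x)"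
      unfolding positive_element_def
      by (intro bexI[of _ x]) (auto simp: bounded_seqs_def ideal_hmod_def bounded)
  next
    fix x y assume "x \<in> carrier (ideal_hmod E)" "y \<in> carrier (ideal_hmod E)"
    then show "ip (ideal_hmod E) x y \<in> carrier bounded_seqs"
      by (simp add: bounded_seqs_def ideal_hmod_def Bseq_mult Bseq_cnj bounded)
  qed (auto simp: bounded_seqs_def ideal_hmod_def algebra_simps mult_closed fun_eq_iff)
qed

section \<open>Multiplication by a nowhere vanishing null sequence\<close>

lemma adjointable_multiplication:
  assumes "\<And>x. x \<in> E \<Longrightarrow> (\<lambda>n. f n * x n) \<in> F"
    and "\<And>y. y \<in> F \<Longrightarrow> (\<lambda>n. cnj (f n) * y n) \<in> E"
  shows "(\<lambda>x n. f n * x n) \<in> adjointable (ideal_hmod E) (ideal_hmod F)"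
  unfolding adjointable_def using assms
  by (auto simp: ideal_hmod_def algebra_simps intro!: bexI[of _ "\<lambda>y n. cnj (f n) * y n"])

text \<open>An adjoint \<open>S\<close> of the inclusion would map the unit of \<open>\<ell>\<^sup>\<infinity>\<close> to a null sequence acting as
  the identity on \<open>c\<^sub>0\<close>. It suffices to test this on one nowhere vanishing \<open>f\<close>.\<close>

lemma inclusion_not_adjointable:
  assumes X: "X \<in> adjointable (ideal_hmod {x. x \<longlonglongrightarrow> 0}) (ideal_hmod {x. Bseq x})"
    and f: "f \<longlonglongrightarrow> 0" "\<And>n. f n \<noteq> 0"
  shows "X f \<noteq> f"
proof
  assume fixed: "X f = f"
  from X obtain S where S: "S \<in> {z. Bseq z} \<rightarrow> {x. x \<longlonglongrightarrow> 0}"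
    and adj: "\<forall>y\<in>{x. x \<longlonglongrightarrow> 0}. \<forall>z\<in>{z. Bseq z}.
      (\<lambda>n. cnj (X y n) * z n) = (\<lambda>n. cnj (y n) * S z n)"
    by (auto simp: adjointable_def ideal_hmod_def)
  have "S (\<lambda>n. 1) = (\<lambda>n. 1)"
    using adj[rule_format, of f "\<lambda>n. 1"] f by (simp add: fixed fun_eq_iff)
  moreover have "S (\<lambda>n. 1) \<longlonglongrightarrow> 0"
    using S by (simp add: Pi_iff)
  ultimately show False by (simp add: LIMSEQ_const_iff)
qed

theorem proposition3p4:
  shows "\<exists>(A :: (nat \<Rightarrow> complex) cstar)
      (H :: (nat \<Rightarrow> complex, nat \<Rightarrow> complex) hmod)
      (K :: (nat \<Rightarrow> complex, nat \<Rightarrow> complex) hmod) T T'.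
    cstar_algebra A \<and> hilbert_module A H \<and> hilbert_module A K \<and>
    T \<in> adjointable H K \<and> T' \<in> adjointable K K \<and>
    T' ` carrier K \<subset> T ` carrier H \<and>
    \<not> (\<exists>X \<in> adjointable K H. \<forall>y \<in> carrier K. T (X y) = T' y)"
proof -
  define f :: "nat \<Rightarrow> complex" where "f = (\<lambda>n. inverse (of_nat (Suc n)))"
  define T :: "(nat \<Rightarrow> complex) \<Rightarrow> nat \<Rightarrow> complex" where "T = (\<lambda>x n. f n * x n)"
  define H where "H = ideal_hmod {x. Bseq x}"
  define K where "K = ideal_hmod {x. x \<longlonglongrightarrow> 0}"
  have f: "f \<longlonglongrightarrow> 0" "\<And>n. f n \<noteq> 0"
    using LIMSEQ_Suc[OF lim_inverse_n[where 'a = complex]]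
    by (auto simp: f_def simp del: of_nat_Suc)
  have null_bounded: "Bseq x" if "x \<longlonglongrightarrow> 0" for x :: "nat \<Rightarrow> complex"
    using that by (intro convergent_imp_Bseq convergentI)
  have inj: "x = y" if "T x = T y" for x y
    using that f(2) by (simp add: T_def fun_eq_iff)
  have f_mult: "(\<lambda>n. f n * x n) \<longlonglongrightarrow> 0" if "Bseq x" for x
    using closed_ideal.mult_closed[OF closed_ideal_null, of f x] f(1) that by simp
  have T: "T \<in> adjointable H K" and T': "T \<in> adjointable K K"
    unfolding T_def H_def K_def
    by (rule adjointable_multiplication;
        auto simp: f_mult intro!: null_bounded Bseq_mult Bseq_cnj f
          tendsto_mult_zero tendsto_cnj[where a = 0, simplified])+
  have "T ` carrier K \<subset> T ` carrier H"
  proof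
    show "T ` carrier K \<subseteq> T ` carrier H"
      by (auto simp: H_def K_def ideal_hmod_def null_bounded)
    have "T (\<lambda>n. 1) \<notin> T ` carrier K"
    proof
      assume "T (\<lambda>n. 1) \<in> T ` carrier K"
      then obtain x where "x \<longlonglongrightarrow> 0" "T (\<lambda>n. 1) = T x"
        by (auto simp: K_def ideal_hmod_def)
      with inj[of "\<lambda>n. 1" x] show False
        by (auto simp: LIMSEQ_const_iff)
    qed
    moreover have "T (\<lambda>n. 1) \<in> T ` carrier H"
      by (auto simp: H_def ideal_hmod_def)
    ultimately show "T ` carrier K \<noteq> T ` carrier H" by blast
  qed
  moreover have "T (X f) \<noteq> T f" if "X \<in> adjointable K H" for X
    using inclusion_not_adjointable[of X f] that f inj unfolding H_def K_def by blast
  moreover have "f \<in> carrier K"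
    using f by (simp add: K_def ideal_hmod_def)
  moreover have "hilbert_module bounded_seqs H" "hilbert_module bounded_seqs K"
    unfolding H_def K_def
    by (rule hilbert_module_ideal closed_ideal_bounded closed_ideal_null)+
  ultimately show ?thesis
    using cstar_algebra_bounded_seqs T T' by blast
qed

end
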